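(* For all positive integers $n$ and $q$, $$\sum_{\pi\in S_{n+q-1}} t^{rmaj_{q,n+q-1}(\pi)}=\sum_{\pi\in S_{n+q-1}} t^{inv_q(\pi)}=q!\,(1+tq)(1+t+t^2q)\cdots(1+t+\cdots+t^{n-2}+t^{n-1}q),$$ where the product has the $n-1$ factors $1+t+\cdots+t^{k-1}+t^kq$, $1\le k\le n-1$, besides $q!$.
   Context: $t$ is an indeterminate. Let $m=n+q-1$ and $\pi\in S_m$. The $q$-inversion number: $inv_q(\pi)=\sum_{i=q+1}^m \min\{\,i-q,\ \#\{j<i\mid \pi(j)>\pi(i)\}\,\}$ (an empty sum, i.e. $0$, if $m\le q$). $Del_q(\pi)=\{ i \mid q+1\le i\le m,\ \#\{j<i\mid \pi(j)<\pi(i)\}\le q-1\}$. The $q$-descent set $Des_q(\pi)$ is the set of $i$ with $q\le i\le m-1$ such that $\pi(i)>\pi(i+1)$ or $i+1\in Del_q(\pi)$ (or both). The $q$-reverse major index: $rmaj_{q,m}(\pi)=\sum_{i\in Des_q(\pi)}(m-i)$. *)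

theory Defs
  imports "HOL-Combinatorics.Permutations" "HOL-Computational_Algebra.Polynomial"
begin

text \<open>A permutation in \<open>S\<^sub>m\<close> is a function \<open>\<pi> :: nat \<Rightarrow> nat\<close> with \<open>\<pi> permutes {1..m}\<close>.
  Such a function also fixes \<open>0\<close>, so positions \<open>j < i\<close> have to be restricted to \<open>j \<in> {1..<i}\<close>.\<close>

definition inv_q :: "nat \<Rightarrow> nat \<Rightarrow> (nat \<Rightarrow> nat) \<Rightarrow> nat" where
  "inv_q q m \<pi> = (\<Sum>i = q + 1..m. min (i - q) (card {j \<in> {1..<i}. \<pi> j > \<pi> i}))"

text \<open>The condition \<open>card \<dots> < q\<close> is \<open>card \<dots> \<le> q - 1\<close> without truncated subtraction; likewise
  \<open>i < m\<close> in the descent set below is \<open>i \<le> m - 1\<close>.\<close>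

definition Del_q :: "nat \<Rightarrow> nat \<Rightarrow> (nat \<Rightarrow> nat) \<Rightarrow> nat set" where
  "Del_q q m \<pi> = {i. q + 1 \<le> i \<and> i \<le> m \<and> card {j \<in> {1..<i}. \<pi> j < \<pi> i} < q}"

definition Des_q :: "nat \<Rightarrow> nat \<Rightarrow> (nat \<Rightarrow> nat) \<Rightarrow> nat set" where
  "Des_q q m \<pi> = {i. q \<le> i \<and> i < m \<and> (\<pi> i > \<pi> (i + 1) \<or> i + 1 \<in> Del_q q m \<pi>)}"

definition rmaj :: "nat \<Rightarrow> nat \<Rightarrow> (nat \<Rightarrow> nat) \<Rightarrow> nat" where
  "rmaj q m \<pi> = (\<Sum>i \<in> Des_q q m \<pi>. m - i)"

text \<open>The indeterminate of \<open>\<int>[t]\<close>.\<close>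

abbreviation indet :: "int poly" where
  "indet \<equiv> monom 1 1"

end

theory Submission
  imports Defs
begin

text \<open>
  Both sums are multiplied by the factor \<open>1 + t + \<dots> + t\<^sup>k\<^sup>-\<^sup>1 + t\<^sup>k q\<close> with \<open>k = m + 1 - q\<close>
  when \<open>S\<^sub>m\<close> (\<open>m \<ge> q\<close>) is replaced by \<open>S\<^sub>m\<^sub>+\<^sub>1\<close>.  On \<open>S\<^sub>q\<close> both statistics vanish, which
  gives \<open>q!\<close>.  The two statistics need different ways of passing from \<open>S\<^sub>m\<close> to \<open>S\<^sub>m\<^sub>+\<^sub>1\<close>.

  For \<open>inv_q\<close>, a last value \<open>v\<close> is appended to \<open>\<sigma>\<close> and the values \<open>\<ge> v\<close> of \<open>\<sigma>\<close> are
  raised by one.  The earlier terms do not change, and the new one is \<open>min k (m + 1 - v)\<close>: it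
  equals \<open>k\<close> for the \<open>q\<close> values \<open>v \<le> q\<close> and runs once through \<open>0, \<dots>, k - 1\<close> for the others
  (\<open>inv_q_cyc_comp\<close>, \<open>sum_power_min\<close>).

  For \<open>rmaj\<close>, the largest letter \<open>m + 1\<close> is inserted into the word of \<open>\<sigma>\<close>, as in Carlitz's
  proof for the ordinary major index.  The key point is that a new largest letter is never
  counted among the smaller letters to the left of another letter; so it leaves unchanged, for
  each old letter, whether fewer than \<open>q\<close> smaller letters precede it.  At each of the first
  \<open>q\<close> positions the insertion creates one new descent, at \<open>q\<close>, because it pushes the old
  letter number \<open>q\<close>, which has fewer than \<open>q\<close> predecessors, to position \<open>q + 1\<close>; this adds
  \<open>m + 1 - q = k\<close> (\<open>rmaj_insert_early\<close>).  At the other \<open>k\<close> positions the insertion acts on descents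
  as in the classical case, and the increments are \<open>0, \<dots>, k - 1\<close> in some order
  (\<open>rmaj_insert_late\<close>, \<open>shift_bij_betw\<close>).

  The two constructions are multiplications by one cycle \<open>cyc m p\<close> or its inverse, from the left
  and from the right; they are exchanged by \<open>\<pi> \<mapsto> \<pi>\<^sup>-\<^sup>1\<close>.
\<close>

section \<open>Decomposing the symmetric group\<close>

text \<open>The cycle \<open>p \<mapsto> p + 1 \<mapsto> \<dots> \<mapsto> m + 1 \<mapsto> p\<close>.  For \<open>\<sigma> \<in> S\<^sub>m\<close>, the permutation
  \<open>cyc m p \<circ> \<sigma>\<close> is \<open>\<sigma>\<close> with the last value \<open>p\<close> appended, and \<open>\<sigma> \<circ> cyc_inv m p\<close> is \<open>\<sigma>\<close> with
  the letter \<open>m + 1\<close> inserted at position \<open>p\<close>.\<close>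

definition cyc :: "nat \<Rightarrow> nat \<Rightarrow> nat \<Rightarrow> nat" where
  "cyc m p i = (if i = Suc m then p else if p \<le> i \<and> i \<le> m then Suc i else i)"

definition cyc_inv :: "nat \<Rightarrow> nat \<Rightarrow> nat \<Rightarrow> nat" where
  "cyc_inv m p i = (if i = p then Suc m else if p < i \<and> i \<le> Suc m then i - 1 else i)"

lemma cyc_cyc_inv:
  assumes "p \<in> {1..Suc m}"
  shows "cyc m p (cyc_inv m p i) = i"
  using assms by (auto simp: cyc_def cyc_inv_def)

lemma cyc_inv_cyc:
  assumes "p \<in> {1..Suc m}"
  shows "cyc_inv m p (cyc m p i) = i"
  using assms by (auto simp: cyc_def cyc_inv_def)

lemma inv_cyc: "p \<in> {1..Suc m} \<Longrightarrow> inv (cyc m p) = cyc_inv m p"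
  by (intro inv_unique_comp ext) (auto simp: cyc_cyc_inv cyc_inv_cyc)

lemma cyc_permutes:
  assumes "p \<in> {1..Suc m}"
  shows "cyc m p permutes {1..Suc m}"
proof (rule inj_imp_permutes)
  show "inj_on (cyc m p) {1..Suc m}"
    by (rule inj_on_inverseI[of _ "cyc_inv m p"]) (rule cyc_inv_cyc[OF assms])
qed (use assms in \<open>auto simp: cyc_def\<close>)

lemma permutes_Suc: "\<sigma> permutes {1..m} \<Longrightarrow> \<sigma> permutes {1..Suc m}"
  by (rule permutes_subset) auto

text \<open>Left cosets of \<open>S\<^sub>m\<close> in \<open>S\<^sub>m\<^sub>+\<^sub>1\<close> are distinguished by the last value, and \<open>cyc m p\<close>
  has last value \<open>p\<close>.\<close>

lemma sum_permutations_Suc_left: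
  fixes g :: "(nat \<Rightarrow> nat) \<Rightarrow> 'a::comm_monoid_add"
  shows "(\<Sum>\<pi> | \<pi> permutes {1..Suc m}. g \<pi>)
    = (\<Sum>\<sigma> | \<sigma> permutes {1..m}. \<Sum>p = 1..Suc m. g (cyc m p \<circ> \<sigma>))"
proof -
  have "(\<Sum>\<sigma> | \<sigma> permutes {1..m}. \<Sum>p = 1..Suc m. g (cyc m p \<circ> \<sigma>))
      = (\<Sum>(\<sigma>, p) \<in> {\<sigma>. \<sigma> permutes {1..m}} \<times> {1..Suc m}. g (cyc m p \<circ> \<sigma>))"
    by (rule sum.cartesian_product)
  also have "\<dots> = (\<Sum>\<pi> | \<pi> permutes {1..Suc m}. g \<pi>)"
  proof (rule sum.reindex_bij_witness
      [where i = "\<lambda>\<pi>. (cyc_inv m (\<pi> (Suc m)) \<circ> \<pi>, \<pi> (Suc m))" and j = "\<lambda>(\<sigma>, p). cyc m p \<circ> \<sigma>"])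
    fix a assume "a \<in> {\<sigma>. \<sigma> permutes {1..m}} \<times> {1..Suc m}"
    then obtain \<sigma> p where a: "a = (\<sigma>, p)" "\<sigma> permutes {1..m}" "p \<in> {1..Suc m}" by blast
    have "\<sigma> (Suc m) = Suc m" using a(2) by (rule permutes_not_in) simp
    then have last: "cyc m p (\<sigma> (Suc m)) = p" by (simp add: cyc_def)
    show "(case a of (\<sigma>, p) \<Rightarrow> cyc m p \<circ> \<sigma>) \<in> {\<pi>. \<pi> permutes {1..Suc m}}"
      using a permutes_compose[OF permutes_Suc cyc_permutes] by simp
    show "(cyc_inv m ((case a of (\<sigma>, p) \<Rightarrow> cyc m p \<circ> \<sigma>) (Suc m)) \<circ> (case a of (\<sigma>, p) \<Rightarrow> cyc m p \<circ> \<sigma>),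
           (case a of (\<sigma>, p) \<Rightarrow> cyc m p \<circ> \<sigma>) (Suc m)) = a"
      using last a by (simp add: fun_eq_iff cyc_inv_cyc)
  next
    fix \<pi> assume "\<pi> \<in> {\<pi>. \<pi> permutes {1..Suc m}}"
    then have \<pi>: "\<pi> permutes {1..Suc m}" by simp
    have p: "\<pi> (Suc m) \<in> {1..Suc m}" using permutes_in_image[OF \<pi>, of "Suc m"] by simp
    have "cyc_inv m (\<pi> (Suc m)) permutes {1..Suc m}"
      using permutes_inv[OF cyc_permutes[OF p]] inv_cyc[OF p] by simp
    then have "cyc_inv m (\<pi> (Suc m)) \<circ> \<pi> permutes {1..Suc m}"
      using \<pi> by (rule permutes_compose[rotated])
    then have "cyc_inv m (\<pi> (Suc m)) \<circ> \<pi> permutes {1..m}"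
      by (rule permutes_superset) (auto simp: cyc_inv_def le_Suc_eq)
    then show "(cyc_inv m (\<pi> (Suc m)) \<circ> \<pi>, \<pi> (Suc m)) \<in> {\<sigma>. \<sigma> permutes {1..m}} \<times> {1..Suc m}"
      using p by simp
    show "(case (cyc_inv m (\<pi> (Suc m)) \<circ> \<pi>, \<pi> (Suc m)) of (\<sigma>, p) \<Rightarrow> cyc m p \<circ> \<sigma>) = \<pi>"
      using cyc_cyc_inv[OF p] by (simp add: fun_eq_iff)
  qed auto
  finally show ?thesis ..
qed

text \<open>The right cosets are the images of the left cosets under inversion.\<close>

lemma sum_permutations_Suc_right:
  fixes g :: "(nat \<Rightarrow> nat) \<Rightarrow> 'a::comm_monoid_add"
  shows "(\<Sum>\<pi> | \<pi> permutes {1..Suc m}. g \<pi>)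
    = (\<Sum>\<sigma> | \<sigma> permutes {1..m}. \<Sum>p = 1..Suc m. g (\<sigma> \<circ> cyc_inv m p))"
proof -
  have inv_comp: "inv (cyc m p \<circ> inv \<sigma>) = \<sigma> \<circ> cyc_inv m p"
    if "\<sigma> permutes {1..m}" "p \<in> {1..Suc m}" for \<sigma> p
    using that permutes_bij[OF cyc_permutes[OF that(2)]]
    by (simp add: o_inv_distrib permutes_bij bij_imp_bij_inv inv_inv_eq inv_cyc)
  have "(\<Sum>\<pi> | \<pi> permutes {1..Suc m}. g \<pi>) = (\<Sum>\<pi> | \<pi> permutes {1..Suc m}. g (inv \<pi>))"
    by (rule sum_permutations_inverse)
  also have "\<dots> = (\<Sum>\<sigma> | \<sigma> permutes {1..m}. \<Sum>p = 1..Suc m. g (inv (cyc m p \<circ> \<sigma>)))"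
    by (rule sum_permutations_Suc_left)
  also have "\<dots> = (\<Sum>\<sigma> | \<sigma> permutes {1..m}. \<Sum>p = 1..Suc m. g (inv (cyc m p \<circ> inv \<sigma>)))"
    by (rule sum_permutations_inverse)
  also have "\<dots> = (\<Sum>\<sigma> | \<sigma> permutes {1..m}. \<Sum>p = 1..Suc m. g (\<sigma> \<circ> cyc_inv m p))"
    using inv_comp by (intro sum.cong refl) simp
  finally show ?thesis .
qed

section \<open>Appending a last value and the inversion number\<close>

lemma cyc_less_iff:
  assumes "a \<le> m" "b \<le> m"
  shows "cyc m v a < cyc m v b \<longleftrightarrow> a < b"
  using assms by (auto simp: cyc_def)

text \<open>Raising the values \<open>\<ge> v\<close> keeps the relative order of the first \<open>m\<close> entries, so only the
  term of position \<open>m + 1\<close> is new; exactly the \<open>m + 1 - v\<close> values above \<open>v\<close> exceed the last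
  entry, and all of them stand to its left.\<close>

lemma inv_q_cyc_comp:
  assumes \<sigma>: "\<sigma> permutes {1..m}" and "q \<le> m" and v: "v \<in> {1..Suc m}"
  shows "inv_q q (Suc m) (cyc m v \<circ> \<sigma>) = inv_q q m \<sigma> + min (Suc m - q) (Suc m - v)"
proof -
  have le: "\<sigma> i \<le> m" if "i \<in> {1..m}" for i
    using that permutes_in_image[OF \<sigma>, of i] by simp
  have old: "{j \<in> {1..<i}. (cyc m v \<circ> \<sigma>) j > (cyc m v \<circ> \<sigma>) i} = {j \<in> {1..<i}. \<sigma> j > \<sigma> i}"
    if "i \<in> {1..m}" for i
  proof (rule Collect_cong, rule conj_cong[OF refl])
    fix j assume "j \<in> {1..<i}"
    with that have "j \<in> {1..m}" by simp
    then show "(cyc m v \<circ> \<sigma>) j > (cyc m v \<circ> \<sigma>) i \<longleftrightarrow> \<sigma> j > \<sigma> i"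
      unfolding comp_apply by (intro cyc_less_iff le that)
  qed
  have "\<sigma> ` {j \<in> {1..<Suc m}. (cyc m v \<circ> \<sigma>) j > v} = {y \<in> \<sigma> ` {1..m}. cyc m v y > v}"
    by auto
  also have "\<dots> = {v..m}"
    using v unfolding permutes_image[OF \<sigma>] by (auto simp: cyc_def)
  finally have im: "\<sigma> ` {j \<in> {1..<Suc m}. (cyc m v \<circ> \<sigma>) j > v} = {v..m}" .
  have "card (\<sigma> ` {j \<in> {1..<Suc m}. (cyc m v \<circ> \<sigma>) j > v})
      = card {j \<in> {1..<Suc m}. (cyc m v \<circ> \<sigma>) j > v}"
    by (rule card_image[OF inj_on_subset[OF permutes_inj[OF \<sigma>]]]) simp
  then have new: "card {j \<in> {1..<Suc m}. (cyc m v \<circ> \<sigma>) j > v} = Suc m - v"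
    unfolding im by simp
  have last: "(cyc m v \<circ> \<sigma>) (Suc m) = v"
    using permutes_not_in[OF \<sigma>, of "Suc m"] by (simp add: cyc_def)
  have "inv_q q (Suc m) (cyc m v \<circ> \<sigma>)
      = (\<Sum>i = q + 1..m. min (i - q) (card {j \<in> {1..<i}. (cyc m v \<circ> \<sigma>) j > (cyc m v \<circ> \<sigma>) i}))
        + min (Suc m - q) (card {j \<in> {1..<Suc m}. (cyc m v \<circ> \<sigma>) j > (cyc m v \<circ> \<sigma>) (Suc m)})"
  proof -
    have "\<not> Suc m < q + 1" using \<open>q \<le> m\<close> by simp
    then show ?thesis unfolding inv_q_def sum.cl_ivl_Suc by (simp only: if_False)
  qed
  also have "(\<Sum>i = q + 1..m. min (i - q) (card {j \<in> {1..<i}. (cyc m v \<circ> \<sigma>) j > (cyc m v \<circ> \<sigma>) i}))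
      = inv_q q m \<sigma>"
    unfolding inv_q_def by (rule sum.cong[OF refl], subst old) simp_all
  finally show ?thesis unfolding last new .
qed

lemma sum_power_min:
  fixes x :: "'a::comm_semiring_1"
  assumes "q \<le> m"
  shows "(\<Sum>v = 1..Suc m. x ^ min (Suc m - q) (Suc m - v))
    = (\<Sum>i<Suc m - q. x ^ i) + x ^ (Suc m - q) * of_nat q"
proof -
  have "{1..Suc m} = {1..q} \<union> {Suc q..Suc m}" using assms by auto
  then have "(\<Sum>v = 1..Suc m. x ^ min (Suc m - q) (Suc m - v))
    = (\<Sum>v = 1..q. x ^ min (Suc m - q) (Suc m - v)) + (\<Sum>v = Suc q..Suc m. x ^ min (Suc m - q) (Suc m - v))"
    by (simp add: sum.union_disjoint)
  also have "(\<Sum>v = 1..q. x ^ min (Suc m - q) (Suc m - v)) = (\<Sum>v = 1..q. x ^ (Suc m - q))"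
    by (intro sum.cong refl arg_cong[where f = "power x"]) auto
  also have "(\<Sum>v = Suc q..Suc m. x ^ min (Suc m - q) (Suc m - v)) = (\<Sum>i<Suc m - q. x ^ i)"
    by (rule sum.reindex_bij_witness[where i = "\<lambda>i. Suc m - i" and j = "\<lambda>v. Suc m - v"])
       (use assms in \<open>auto simp: min_def intro!: arg_cong[where f = "power x"]\<close>)
  finally show ?thesis by (simp add: mult.commute add.commute)
qed

section \<open>Inserting the largest letter and the reverse major index\<close>

text \<open>The number of smaller letters to the left belongs to a letter, not to its position: it
  survives the insertion of a larger letter.  This controls \<open>Del_q\<close> after an insertion.\<close>

lemma card_left_smaller_insert:
  assumes \<sigma>: "\<sigma> permutes {1..m}" and p: "p \<in> {1..Suc m}" and i: "i \<in> {1..Suc m}"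
  defines "\<pi> \<equiv> \<sigma> \<circ> cyc_inv m p"
  shows "card {j \<in> {1..<i}. \<pi> j < \<pi> i} =
    (if i < p then card {j \<in> {1..<i}. \<sigma> j < \<sigma> i}
     else if i = p then p - 1
     else card {j \<in> {1..<i - 1}. \<sigma> j < \<sigma> (i - 1)})"
proof -
  have top: "\<sigma> (Suc m) = Suc m" using \<sigma> by (rule permutes_not_in) simp
  have below: "\<sigma> j < Suc m" if "j \<in> {1..m}" for j
    using permutes_in_image[OF \<sigma>, of j] that by simp
  consider "i < p" | "i = p" | "i > p" by linarith
  then show ?thesis
  proof cases
    case 1
    then have "{j \<in> {1..<i}. \<pi> j < \<pi> i} = {j \<in> {1..<i}. \<sigma> j < \<sigma> i}"
      by (auto simp: \<pi>_def cyc_inv_def)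
    with 1 show ?thesis by simp
  next
    case 2
    then have "{j \<in> {1..<i}. \<pi> j < \<pi> i} = {1..<p}"
      using p top below by (auto simp: \<pi>_def cyc_inv_def)
    with 2 show ?thesis by simp
  next
    case 3
    have pi: "\<pi> (cyc m p j) = \<sigma> j" for j by (simp add: \<pi>_def cyc_inv_cyc[OF p])
    have "i = cyc m p (i - 1)" using 3 i by (auto simp: cyc_def)
    then have pi_i: "\<pi> i = \<sigma> (i - 1)" using pi by metis
    have i1: "i - 1 \<in> {1..m}" using 3 p i by auto
    have "{j \<in> {1..<i}. \<pi> j < \<pi> i} = cyc m p ` {j \<in> {1..<i - 1}. \<sigma> j < \<sigma> (i - 1)}"
      (is "?L = ?R")
    proof (intro equalityI subsetI)
      fix j assume j: "j \<in> ?L"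
      \<comment> \<open>The inserted letter is at \<open>p\<close>; being the largest, it is never counted.\<close>
      have "j \<noteq> p"
        using j pi_i top below[OF i1] by (auto simp: \<pi>_def cyc_inv_def)
      then have "cyc_inv m p j \<in> {1..<i - 1}"
        using j 3 i p by (auto simp: cyc_inv_def)
      moreover have "\<sigma> (cyc_inv m p j) < \<sigma> (i - 1)" using j pi_i by (simp add: \<pi>_def)
      ultimately show "j \<in> ?R"
        by (intro image_eqI[of _ _ "cyc_inv m p j"]) (auto simp: cyc_cyc_inv[OF p])
    next
      fix j assume "j \<in> ?R"
      then obtain l where l: "j = cyc m p l" "l \<in> {1..<i - 1}" "\<sigma> l < \<sigma> (i - 1)" by auto
      moreover have "j \<in> {1..<i}" using l(1,2) i by (auto simp: cyc_def)
      ultimately show "j \<in> ?L" using pi pi_i by simp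
    qed
    moreover have "inj (cyc m p)" using permutes_inj[OF cyc_permutes[OF p]] .
    ultimately show ?thesis using 3 by (simp add: card_image inj_on_subset)
  qed
qed

text \<open>When \<open>p > q\<close>, the gap before the new letter is not a descent, since that letter is larger
  than its predecessor and has \<open>p - 1 \<ge> q\<close> smaller letters to its left; the gap after it is a
  descent.  When \<open>p \<le> q\<close>, the old letter at position \<open>q\<close> enters \<open>Del_q\<close> at position \<open>q + 1\<close>.
  All other gaps keep their status and move along with their letters.\<close>

lemma Des_q_insert:
  assumes \<sigma>: "\<sigma> permutes {1..m}" and "1 \<le> q" "q \<le> m" and p: "p \<in> {1..Suc m}"
    and i: "q \<le> i" "i < Suc m"
  shows "i \<in> Des_q q (Suc m) (\<sigma> \<circ> cyc_inv m p) \<longleftrightarrow>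
    (if p \<le> q then i = q \<or> i - 1 \<in> Des_q q m \<sigma>
     else if Suc i < p then i \<in> Des_q q m \<sigma>
     else if Suc i = p then False
     else i = p \<or> i - 1 \<in> Des_q q m \<sigma>)"
proof -
  have top: "\<sigma> (Suc m) = Suc m" using \<sigma> by (rule permutes_not_in) simp
  have below: "\<sigma> j < Suc m" if "j \<in> {1..m}" for j
    using permutes_in_image[OF \<sigma>, of j] that by simp
  note c = card_left_smaller_insert[OF \<sigma> p, of "Suc i"]
  have less_q: "card {j \<in> {1..<q}. \<sigma> j < \<sigma> q} < q"
  proof -
    have "card {j \<in> {1..<q}. \<sigma> j < \<sigma> q} \<le> card {1..<q}" by (intro card_mono) auto
    with \<open>1 \<le> q\<close> show ?thesis by simp
  qed
  have Del: "Suc i \<in> Del_q q (Suc m) \<pi> \<longleftrightarrow> card {j \<in> {1..<Suc i}. \<pi> j < \<pi> (Suc i)} < q" for \<pi>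
    using i by (auto simp: Del_q_def)
  consider "p \<le> q" "i = q" | "p \<le> q" "i > q" | "p > q" "Suc i < p" | "Suc i = p" "p > q"
    | "i = p" "p > q" | "i > p" "p > q" using i by linarith
  then show ?thesis
  proof cases
    case 1
    then have "Suc i \<in> Del_q q (Suc m) (\<sigma> \<circ> cyc_inv m p)"
      unfolding Del using c i less_q by simp
    then show ?thesis using 1 i by (simp add: Des_q_def)
  next
    case 2
    then have "card {j \<in> {1..<Suc i}. (\<sigma> \<circ> cyc_inv m p) j < (\<sigma> \<circ> cyc_inv m p) (Suc i)}
      = card {j \<in> {1..<i}. \<sigma> j < \<sigma> i}" using c i by simp
    then show ?thesis using 2 i Del[of "\<sigma> \<circ> cyc_inv m p"]
      by (auto simp: Des_q_def Del_q_def cyc_inv_def)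
  next
    case 3
    then have "card {j \<in> {1..<Suc i}. (\<sigma> \<circ> cyc_inv m p) j < (\<sigma> \<circ> cyc_inv m p) (Suc i)}
      = card {j \<in> {1..<Suc i}. \<sigma> j < \<sigma> (Suc i)}" using c i by simp
    then show ?thesis using 3 i p Del[of "\<sigma> \<circ> cyc_inv m p"]
      by (auto simp: Des_q_def Del_q_def cyc_inv_def)
  next
    case 4
    then have "card {j \<in> {1..<Suc i}. (\<sigma> \<circ> cyc_inv m p) j < (\<sigma> \<circ> cyc_inv m p) (Suc i)} = i"
      using c i by simp
    then show ?thesis using 4 i \<open>1 \<le> q\<close> top below[of i] Del[of "\<sigma> \<circ> cyc_inv m p"]
      by (auto simp: Des_q_def cyc_inv_def)
  next
    case 5
    then show ?thesis using i \<open>1 \<le> q\<close> top below[of i]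
      by (auto simp: Des_q_def cyc_inv_def)
  next
    case 6
    then have "card {j \<in> {1..<Suc i}. (\<sigma> \<circ> cyc_inv m p) j < (\<sigma> \<circ> cyc_inv m p) (Suc i)}
      = card {j \<in> {1..<i}. \<sigma> j < \<sigma> i}" using c i by simp
    then show ?thesis using 6 i Del[of "\<sigma> \<circ> cyc_inv m p"]
      by (auto simp: Des_q_def Del_q_def cyc_inv_def)
  qed
qed

lemma Des_q_subset: "Des_q q m \<sigma> \<subseteq> {q..<m}"
  by (auto simp: Des_q_def)

lemma finite_Des_q: "finite (Des_q q m \<sigma>)"
  by (rule finite_subset[OF Des_q_subset]) simp

text \<open>The weight \<open>m - i\<close> counts the letters to the right of gap \<open>i\<close>.  All old descents lie to the
  right of the inserted letter and keep their weights; the new descent \<open>q\<close> is the whole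
  change.\<close>

lemma rmaj_insert_early:
  assumes \<sigma>: "\<sigma> permutes {1..m}" and q: "1 \<le> q" "q \<le> m" and p: "p \<in> {1..q}"
  shows "rmaj q (Suc m) (\<sigma> \<circ> cyc_inv m p) = rmaj q m \<sigma> + (Suc m - q)"
proof -
  have p': "p \<in> {1..Suc m}" using p q by auto
  have "i \<in> Des_q q (Suc m) (\<sigma> \<circ> cyc_inv m p) \<longleftrightarrow> i \<in> insert q (Suc ` Des_q q m \<sigma>)" for i
  proof (cases "q \<le> i \<and> i < Suc m")
    case True
    then have "i \<in> Des_q q (Suc m) (\<sigma> \<circ> cyc_inv m p) \<longleftrightarrow> i = q \<or> i - 1 \<in> Des_q q m \<sigma>"
      using Des_q_insert[OF \<sigma> q p'] p by simp
    then show ?thesis using True q by (cases i) auto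
  next
    case False
    then show ?thesis using q by (auto simp: Des_q_def)
  qed
  then have "Des_q q (Suc m) (\<sigma> \<circ> cyc_inv m p) = insert q (Suc ` Des_q q m \<sigma>)" by blast
  moreover have "q \<notin> Suc ` Des_q q m \<sigma>" using Des_q_subset by fastforce
  ultimately show ?thesis
    by (simp add: rmaj_def finite_Des_q sum.reindex)
qed

text \<open>The increase of the reverse major index when the largest letter is inserted into gap
  \<open>g \<ge> q\<close>, that is, right after position \<open>g\<close>, and \<open>D\<close> is the descent set: each descent to the
  left of \<open>g\<close> gains one letter to its right, and the gap after the new letter has weight
  \<open>m - g\<close>, which replaces an equal weight if \<open>g\<close> was already a descent.\<close>

definition shift :: "nat set \<Rightarrow> nat \<Rightarrow> nat \<Rightarrow> nat" where
  "shift D m g = card {i \<in> D. i < g} + (if g \<in> D then 0 else m - g)"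

lemma rmaj_insert_late:
  assumes \<sigma>: "\<sigma> permutes {1..m}" and q: "1 \<le> q" "q \<le> m" and g: "g \<in> {q..m}"
  shows "rmaj q (Suc m) (\<sigma> \<circ> cyc_inv m (Suc g)) = rmaj q m \<sigma> + shift (Des_q q m \<sigma>) m g"
proof -
  define D where "D = Des_q q m \<sigma>"
  define L where "L = {i \<in> D. i < g}"
  define R where "R = {i \<in> D. g < i}"
  have fin: "finite L" "finite R" by (simp_all add: L_def R_def D_def finite_Des_q)
  have Dm: "D \<subseteq> {q..<m}" unfolding D_def by (rule Des_q_subset)
  have p: "Suc g \<in> {1..Suc m}" using g by auto
  have mem: "i \<in> Des_q q (Suc m) (\<sigma> \<circ> cyc_inv m (Suc g)) \<longleftrightarrow> i \<in> L \<union> {Suc g} \<inter> {..m} \<union> Suc ` R" for i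
  proof (cases "q \<le> i \<and> i < Suc m")
    case True
    then have "i \<in> Des_q q (Suc m) (\<sigma> \<circ> cyc_inv m (Suc g)) \<longleftrightarrow>
      (if i < g then i \<in> D else if i = g then False else i = Suc g \<or> i - 1 \<in> D)"
      using Des_q_insert[OF \<sigma> q p] g by (simp add: D_def)
    then show ?thesis using True q g by (cases i) (auto simp: L_def R_def)
  next
    case False
    then show ?thesis using q g Dm by (auto simp: Des_q_def L_def R_def)
  qed
  have "Des_q q (Suc m) (\<sigma> \<circ> cyc_inv m (Suc g)) = L \<union> {Suc g} \<inter> {..m} \<union> Suc ` R"
    using mem by blast
  moreover have "(L \<union> {Suc g} \<inter> {..m}) \<inter> Suc ` R = {}" "L \<inter> ({Suc g} \<inter> {..m}) = {}"
    by (auto simp: L_def R_def)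
  ultimately have "rmaj q (Suc m) (\<sigma> \<circ> cyc_inv m (Suc g))
      = (\<Sum>i\<in>L. Suc m - i) + (\<Sum>i\<in>{Suc g} \<inter> {..m}. Suc m - i) + (\<Sum>i\<in>Suc ` R. Suc m - i)"
    using fin by (simp add: rmaj_def sum.union_disjoint)
  also have "(\<Sum>i\<in>L. Suc m - i) = (\<Sum>i\<in>L. (m - i) + 1)"
  proof (rule sum.cong[OF refl])
    fix i assume "i \<in> L"
    then have "i \<le> m" using g by (simp add: L_def)
    then show "Suc m - i = (m - i) + 1" by (simp add: Suc_diff_le)
  qed
  \<comment> \<open>For \<open>g = m\<close> the new letter is last and creates no descent; then both sides are \<open>0\<close>.\<close>
  also have "(\<Sum>i\<in>{Suc g} \<inter> {..m}. Suc m - i) = m - g"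
    by (cases "g < m") auto
  also have "(\<Sum>i\<in>Suc ` R. Suc m - i) = (\<Sum>i\<in>R. m - i)"
    by (simp add: sum.reindex)
  finally have new: "rmaj q (Suc m) (\<sigma> \<circ> cyc_inv m (Suc g))
      = (\<Sum>i\<in>L. m - i) + card L + (m - g) + (\<Sum>i\<in>R. m - i)"
    by (simp only: sum.distrib) simp
  have "D = L \<union> D \<inter> {g} \<union> R" by (auto simp: L_def R_def)
  then have "rmaj q m \<sigma> = (\<Sum>i\<in>L \<union> D \<inter> {g} \<union> R. m - i)"
    by (simp add: rmaj_def D_def)
  also have "\<dots> = (\<Sum>i\<in>L. m - i) + (\<Sum>i\<in>D \<inter> {g}. m - i) + (\<Sum>i\<in>R. m - i)"
  proof -
    have "(L \<union> D \<inter> {g}) \<inter> R = {}" "L \<inter> (D \<inter> {g}) = {}" by (auto simp: L_def R_def)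
    with fin show ?thesis by (simp add: sum.union_disjoint)
  qed
  also have "(\<Sum>i\<in>D \<inter> {g}. m - i) = (if g \<in> D then m - g else 0)" by simp
  finally show ?thesis using new unfolding shift_def D_def[symmetric] L_def[symmetric] by simp
qed

text \<open>Read from left to right, the gaps in \<open>D\<close> receive \<open>0, 1, \<dots>, card D - 1\<close>; read from right to
  left, the gaps outside \<open>D\<close>, starting with the final gap \<open>m\<close>, receive \<open>card D, card D + 1, \<dots>\<close>.
  It is enough to prove injectivity and the bound, because both sides have the same size.\<close>

lemma shift_bij_betw:
  assumes D: "D \<subseteq> {q..<m}" and "q \<le> m"
  shows "bij_betw (shift D m) {q..m} {..<Suc m - q}"
proof -
  have fin: "finite D" using D finite_subset by blast
  have descent_bound: "shift D m g < card D" if "g \<in> D" for g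
    using that fin unfolding shift_def by (auto intro!: psubset_card_mono)
  have split: "card {i \<in> D. i < b} = card {i \<in> D. i < a} + card {i \<in> D. a \<le> i \<and> i < b}"
    if "a \<le> b" for a b
  proof -
    have "{i \<in> D. i < b} = {i \<in> D. i < a} \<union> {i \<in> D. a \<le> i \<and> i < b}" using that by auto
    moreover have "{i \<in> D. i < a} \<inter> {i \<in> D. a \<le> i \<and> i < b} = {}" by auto
    ultimately show ?thesis using fin by (simp add: card_Un_disjoint)
  qed
  \<comment> \<open>The strict inequality makes \<open>shift\<close> strictly decreasing on the gaps outside \<open>D\<close>.\<close>
  have few: "card {i \<in> D. a \<le> i \<and> i < b} < b - a" if "a < b" "a \<notin> D" for a b
  proof -
    have "{i \<in> D. a \<le> i \<and> i < b} \<subseteq> {a<..<b}" using that by (auto simp: le_less)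
    then have "card {i \<in> D. a \<le> i \<and> i < b} \<le> card {a<..<b}" by (intro card_mono) auto
    with that show ?thesis by simp
  qed
  have nondescent_bound: "card D \<le> shift D m g" if "g \<notin> D" "g \<le> m" for g
  proof -
    have "card {i \<in> D. g \<le> i \<and> i < m} \<le> m - g"
      using few[of g m] that by (cases "g < m") auto
    moreover have "{i \<in> D. i < m} = D" using D by auto
    ultimately show ?thesis using split[OF that(2)] that by (simp add: shift_def)
  qed
  have distinct: "shift D m a \<noteq> shift D m b" if "a < b" "b \<le> m" for a b
  proof (cases "a \<in> D"; cases "b \<in> D")
    assume "a \<in> D" "b \<in> D"
    then have "{i \<in> D. i < a} \<subset> {i \<in> D. i < b}" using \<open>a < b\<close> by auto
    then have "card {i \<in> D. i < a} < card {i \<in> D. i < b}" using fin by (intro psubset_card_mono) auto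
    with \<open>a \<in> D\<close> \<open>b \<in> D\<close> show ?thesis by (simp add: shift_def)
  next
    assume "a \<notin> D" "b \<notin> D"
    then show ?thesis using that split[of a b] few[of a b] by (simp add: shift_def)
  next
    assume "a \<in> D" "b \<notin> D"
    then show ?thesis using that descent_bound[of a] nondescent_bound[of b] by simp
  next
    assume "a \<notin> D" "b \<in> D"
    then show ?thesis using that descent_bound[of b] nondescent_bound[of a] by simp
  qed
  have inj: "inj_on (shift D m) {q..m}"
    by (rule linorder_inj_onI) (use distinct in auto)
  have "shift D m ` {q..m} \<subseteq> {..<Suc m - q}"
  proof clarify
    fix g assume g: "g \<in> {q..m}"
    have "card {i \<in> D. i < g} \<le> card {q..<g}" using D by (intro card_mono) auto
    with g show "shift D m g < Suc m - q" by (auto simp: shift_def)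
  qed
  moreover have "card (shift D m ` {q..m}) = card {..<Suc m - q}"
    using inj by (simp add: card_image)
  ultimately show ?thesis
    using inj by (simp add: bij_betw_def card_subset_eq)
qed

lemma sum_rmaj_insert:
  fixes x :: "'a::comm_semiring_1"
  assumes \<sigma>: "\<sigma> permutes {1..m}" and q: "1 \<le> q" "q \<le> m"
  shows "(\<Sum>p = 1..Suc m. x ^ rmaj q (Suc m) (\<sigma> \<circ> cyc_inv m p))
    = x ^ rmaj q m \<sigma> * ((\<Sum>i<Suc m - q. x ^ i) + x ^ (Suc m - q) * of_nat q)"
proof -
  define e where "e p = rmaj q (Suc m) (\<sigma> \<circ> cyc_inv m p)" for p
  have "{1..Suc m} = {1..q} \<union> {Suc q..Suc m}" using q by auto
  then have "(\<Sum>p = 1..Suc m. x ^ e p) = (\<Sum>p = 1..q. x ^ e p) + (\<Sum>p = Suc q..Suc m. x ^ e p)"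
    by (simp add: sum.union_disjoint)
  also have "(\<Sum>p = 1..q. x ^ e p) = (\<Sum>p = 1..q. x ^ (rmaj q m \<sigma> + (Suc m - q)))"
    using rmaj_insert_early[OF \<sigma> q] by (intro sum.cong refl) (simp add: e_def)
  also have "(\<Sum>p = Suc q..Suc m. x ^ e p) = (\<Sum>g = q..m. x ^ e (Suc g))"
    by (rule sum.shift_bounds_cl_Suc_ivl)
  also have "\<dots> = (\<Sum>g = q..m. x ^ rmaj q m \<sigma> * x ^ shift (Des_q q m \<sigma>) m g)"
    using rmaj_insert_late[OF \<sigma> q] by (intro sum.cong refl) (simp add: e_def power_add)
  also have "\<dots> = (\<Sum>i<Suc m - q. x ^ rmaj q m \<sigma> * x ^ i)"
    by (rule sum.reindex_bij_betw[OF shift_bij_betw[OF Des_q_subset q(2)]])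
  finally show ?thesis
    by (simp add: e_def power_add sum_distrib_left algebra_simps)
qed

section \<open>The generating functions\<close>

lemma sum_permutations_inv_q:
  fixes x :: "'a::{comm_semiring_1, semiring_char_0}"
  shows "(\<Sum>\<pi> | \<pi> permutes {1..q + k}. x ^ inv_q q (q + k) \<pi>)
    = fact q * (\<Prod>k = 1..k. (\<Sum>i<k. x ^ i) + x ^ k * of_nat q)"
proof (induction k)
  case 0
  show ?case by (simp add: inv_q_def card_permutations)
next
  case (Suc k)
  let ?m = "q + k"
  have "(\<Sum>\<pi> | \<pi> permutes {1..Suc ?m}. x ^ inv_q q (Suc ?m) \<pi>)
      = (\<Sum>\<sigma> | \<sigma> permutes {1..?m}. \<Sum>v = 1..Suc ?m. x ^ inv_q q (Suc ?m) (cyc ?m v \<circ> \<sigma>))"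
    by (rule sum_permutations_Suc_left)
  also have "\<dots> = (\<Sum>\<sigma> | \<sigma> permutes {1..?m}. \<Sum>v = 1..Suc ?m. x ^ inv_q q ?m \<sigma> * x ^ min (Suc ?m - q) (Suc ?m - v))"
    by (intro sum.cong refl) (simp add: inv_q_cyc_comp power_add)
  also have "\<dots> = (\<Sum>\<sigma> | \<sigma> permutes {1..?m}. x ^ inv_q q ?m \<sigma>)
      * ((\<Sum>i<Suc k. x ^ i) + x ^ Suc k * of_nat q)"
    unfolding sum_distrib_left[symmetric] sum_power_min[OF le_add1]
    by (simp add: sum_distrib_right)
  also have "\<dots> = fact q * (\<Prod>k = 1..Suc k. (\<Sum>i<k. x ^ i) + x ^ k * of_nat q)"
    unfolding Suc.IH by (simp add: mult.assoc)
  finally show ?case by (simp only: add_Suc_right)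
qed

lemma sum_permutations_rmaj:
  fixes x :: "'a::{comm_semiring_1, semiring_char_0}"
  assumes "1 \<le> q"
  shows "(\<Sum>\<pi> | \<pi> permutes {1..q + k}. x ^ rmaj q (q + k) \<pi>)
    = fact q * (\<Prod>k = 1..k. (\<Sum>i<k. x ^ i) + x ^ k * of_nat q)"
proof (induction k)
  case 0
  have "rmaj q q \<pi> = 0" for \<pi> by (simp add: rmaj_def Des_q_def)
  then show ?case by (simp add: card_permutations)
next
  case (Suc k)
  let ?m = "q + k"
  have "(\<Sum>\<pi> | \<pi> permutes {1..Suc ?m}. x ^ rmaj q (Suc ?m) \<pi>)
      = (\<Sum>\<sigma> | \<sigma> permutes {1..?m}. \<Sum>p = 1..Suc ?m. x ^ rmaj q (Suc ?m) (\<sigma> \<circ> cyc_inv ?m p))"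
    by (rule sum_permutations_Suc_right)
  also have "\<dots> = (\<Sum>\<sigma> | \<sigma> permutes {1..?m}. x ^ rmaj q ?m \<sigma>
      * ((\<Sum>i<Suc ?m - q. x ^ i) + x ^ (Suc ?m - q) * of_nat q))"
    by (intro sum.cong refl sum_rmaj_insert) (use assms in auto)
  also have "\<dots> = (\<Sum>\<sigma> | \<sigma> permutes {1..?m}. x ^ rmaj q ?m \<sigma>)
      * ((\<Sum>i<Suc k. x ^ i) + x ^ Suc k * of_nat q)"
    by (simp add: sum_distrib_right)
  also have "\<dots> = fact q * (\<Prod>k = 1..Suc k. (\<Sum>i<k. x ^ i) + x ^ k * of_nat q)"
    unfolding Suc.IH by (simp add: mult.assoc)
  finally show ?case by (simp only: add_Suc_right)
qed

theorem theorem2p5: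
  fixes n q :: nat
  assumes "n \<ge> 1" and "q \<ge> 1"
  shows "(\<Sum>\<pi> | \<pi> permutes {1..n + q - 1}. indet ^ rmaj q (n + q - 1) \<pi>)
           = (\<Sum>\<pi> | \<pi> permutes {1..n + q - 1}. indet ^ inv_q q (n + q - 1) \<pi>)
       \<and> (\<Sum>\<pi> | \<pi> permutes {1..n + q - 1}. indet ^ inv_q q (n + q - 1) \<pi>)
           = fact q * (\<Prod>k = 1..n - 1. (\<Sum>i<k. indet ^ i) + indet ^ k * of_nat q)"
proof -
  have "n + q - 1 = q + (n - 1)" using assms(1) by simp
  then show ?thesis
    by (simp only: sum_permutations_rmaj[OF assms(2)] sum_permutations_inv_q)
qed

end
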